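(* Let $N\ge 1$, $1<p<\infty$, $h>0$. Let $J\in C^1(\mathbb{R}^N)$ be non-negative, even, supported in the ball of center $0$ and radius $1$, with bounded first-order partial derivatives, and suppose there is $0<S<\infty$ such that for each $i=1,\dots,N$, $\sup_{x\in\mathbb{R}^N}\int_{\mathbb{R}^N}|\partial_{x_i}J(x-y)|\,dy\le S$ and $\sup_{y\in\mathbb{R}^N}\int_{\mathbb{R}^N}|\partial_{x_i}J(x-y)|\,dx\le S$. Let $f:\mathbb{R}\to\mathbb{R}$ be non-negative, nondecreasing, globally Lipschitz (there is $k_1>0$ with $|f(x)-f(y)|\le k_1|x-y|$ for all $x,y\in\mathbb{R}$) and bounded: there is $a>0$ with $|f(x)|\le a$ for all $x\in\mathbb{R}$. Let $\rho:\mathbb{R}^N\to\mathbb{R}$ be an integrable positive even function with $\int_{\mathbb{R}^N}\rho(x)\,dx=1$, and suppose there is a constant $K>0$ such that $\sup\{\rho(x): x\in\mathbb{R}^N,\ |x-y|\le 1\}\le K\rho(y)$ for all $y\in\mathbb{R}^N$. Let $\mathcal{A}\subset L^p(\mathbb{R}^N,\rho)$ be the global attractor of the flow $S(t)$ generated in $L^p(\mathbb{R}^N,\rho)$ by $$\frac{\partial u}{\partial t}(x,t)=-u(x,t)+\int_{\mathbb{R}^N}J(x-y)f(u(y,t))\,dy+h.$$ Then every $u\in\mathcal{A}$ satisfies $\|u\|_{L^\infty(\mathbb{R}^N)}\le r$, where $r=a\|J\|_{L^1}+h$.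
   Context: $L^p(\mathbb{R}^N,\rho)=\{u\in L^1_{\rm loc}(\mathbb{R}^N):\int_{\mathbb{R}^N}|u(x)|^p\rho(x)\,dx<\infty\}$ with norm $\|u\|_{L^p(\mathbb{R}^N,\rho)}=\left(\int_{\mathbb{R}^N}|u(x)|^p\rho(x)\,dx\right)^{1/p}$. The equation is regarded as an ODE $\dot u=F(u)$, $F(u)=-u+J*(f\circ u)+h$, in the Banach space $L^p(\mathbb{R}^N,\rho)$, where $(J*v)(x)=\int_{\mathbb{R}^N}J(x-y)v(y)\,dy$; $F$ is globally Lipschitz, so for each $u_0\in L^p(\mathbb{R}^N,\rho)$ there is a unique global solution, and $S(t)u_0$ denotes its value at time $t$. The global attractor (which exists under these hypotheses) is the compact set $\mathcal{A}$, invariant ($S(t)\mathcal{A}=\mathcal{A}$ for all $t\ge0$) and maximal with this property among bounded sets, which attracts every bounded set $B\subset L^p(\mathbb{R}^N,\rho)$, i.e. $\sup_{b\in B}\inf_{y\in\mathcal{A}}\|S(t)b-y\|_{L^p(\mathbb{R}^N,\rho)}\to0$ as $t\to\infty$. *)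

theory Defs
  imports "HOL-Analysis.Analysis" "HOL-Probability.Essential_Supremum"
begin

text \<open>The weighted space \<open>L\<^sup>p(\<real>\<^sup>N, \<rho>)\<close>. Its members are the classes of the set \<open>Lp_fun p \<rho>\<close>
  under equality almost everywhere, so \<open>Lp_dist\<close> separates points.\<close>

definition locally_integrable :: "(real^'n \<Rightarrow> real) \<Rightarrow> bool" where
  "locally_integrable u \<longleftrightarrow> (\<forall>C. compact C \<longrightarrow> u absolutely_integrable_on C)"

definition Lp_fun :: "real \<Rightarrow> (real^'n \<Rightarrow> real) \<Rightarrow> (real^'n \<Rightarrow> real) set" where
  "Lp_fun p \<rho> = {u. locally_integrable u \<and> integrable lebesgue (\<lambda>x. \<bar>u x\<bar> powr p * \<rho> x)}"

definition Lp_norm :: "real \<Rightarrow> (real^'n \<Rightarrow> real) \<Rightarrow> (real^'n \<Rightarrow> real) \<Rightarrow> real" where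
  "Lp_norm p \<rho> u = (LINT x|lebesgue. \<bar>u x\<bar> powr p * \<rho> x) powr (1 / p)"

definition Lp :: "real \<Rightarrow> (real^'n \<Rightarrow> real) \<Rightarrow> (real^'n \<Rightarrow> real) set set" where
  "Lp p \<rho> = Lp_fun p \<rho> //
     {(u, v). u \<in> Lp_fun p \<rho> \<and> v \<in> Lp_fun p \<rho> \<and> (AE x in lebesgue. u x = v x)}"

definition Lp_rep :: "(real^'n \<Rightarrow> real) set \<Rightarrow> real^'n \<Rightarrow> real" where
  "Lp_rep X = (SOME u. u \<in> X)"

definition Lp_dist ::
    "real \<Rightarrow> (real^'n \<Rightarrow> real) \<Rightarrow> (real^'n \<Rightarrow> real) set \<Rightarrow> (real^'n \<Rightarrow> real) set \<Rightarrow> real" where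
  "Lp_dist p \<rho> X Y = Lp_norm p \<rho> (\<lambda>x. Lp_rep X x - Lp_rep Y x)"

definition Linf_norm :: "(real^'n \<Rightarrow> real) \<Rightarrow> ereal" where
  "Linf_norm u = esssup lebesgue (\<lambda>x. ereal \<bar>u x\<bar>)"

definition partial_deriv :: "'n \<Rightarrow> (real^'n \<Rightarrow> real) \<Rightarrow> real^'n \<Rightarrow> real" where
  "partial_deriv i J x = frechet_derivative J (at x) (axis i 1)"

definition C1_fun :: "(real^'n \<Rightarrow> real) \<Rightarrow> bool" where
  "C1_fun J \<longleftrightarrow> J differentiable_on UNIV \<and> (\<forall>i. continuous_on UNIV (partial_deriv i J))"

definition convol :: "(real^'n \<Rightarrow> real) \<Rightarrow> (real^'n \<Rightarrow> real) \<Rightarrow> real^'n \<Rightarrow> real" where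
  "convol J v x = (LINT y|lebesgue. J (x - y) * v y)"

definition vfield ::
    "(real^'n \<Rightarrow> real) \<Rightarrow> (real \<Rightarrow> real) \<Rightarrow> real \<Rightarrow> (real^'n \<Rightarrow> real) \<Rightarrow> real^'n \<Rightarrow> real" where
  "vfield J f h u x = - u x + convol J (f \<circ> u) x + h"

text \<open>A global solution of \<open>du/dt = F(u)\<close> on \<open>[0, \<infinity>)\<close>: the difference quotients converge to
  \<open>F(u(t))\<close> in the \<open>L\<^sup>p(\<rho>)\<close> norm (one-sidedly at \<open>t = 0\<close>).\<close>

definition global_solution ::
    "real \<Rightarrow> (real^'n \<Rightarrow> real) \<Rightarrow> (real^'n \<Rightarrow> real) \<Rightarrow> (real \<Rightarrow> real) \<Rightarrow> real
      \<Rightarrow> (real \<Rightarrow> (real^'n \<Rightarrow> real) set) \<Rightarrow> bool" where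
  "global_solution p \<rho> J f h U \<longleftrightarrow>
     (\<forall>t\<ge>0. U t \<in> Lp p \<rho> \<and>
       ((\<lambda>s. Lp_norm p \<rho> (\<lambda>x. (Lp_rep (U s) x - Lp_rep (U t) x) / (s - t)
                               - vfield J f h (Lp_rep (U t)) x))
          \<longlongrightarrow> 0) (at t within {0..}))"

text \<open>\<open>S t X\<close> is the value at time \<open>t\<close> of the global solution starting at \<open>X\<close>;
  only \<open>t \<ge> 0\<close> and \<open>X \<in> Lp p \<rho>\<close> matter.\<close>

definition generated_flow ::
    "real \<Rightarrow> (real^'n \<Rightarrow> real) \<Rightarrow> (real^'n \<Rightarrow> real) \<Rightarrow> (real \<Rightarrow> real) \<Rightarrow> real
      \<Rightarrow> (real \<Rightarrow> (real^'n \<Rightarrow> real) set \<Rightarrow> (real^'n \<Rightarrow> real) set) \<Rightarrow> bool" where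
  "generated_flow p \<rho> J f h S \<longleftrightarrow>
     (\<forall>X\<in>Lp p \<rho>. S 0 X = X \<and> global_solution p \<rho> J f h (\<lambda>t. S t X))"

text \<open>The attraction condition is stated in \<open>ennreal\<close>, so that the supremum and the infimum are
  meaningful also for empty and unbounded families.\<close>

definition global_attractor ::
    "'a set \<Rightarrow> ('a \<Rightarrow> 'a \<Rightarrow> real) \<Rightarrow> (real \<Rightarrow> 'a \<Rightarrow> 'a) \<Rightarrow> 'a set \<Rightarrow> bool" where
  "global_attractor M d S A \<longleftrightarrow>
     compactin (Metric_space.mtopology M d) A \<and>
     (\<forall>t\<ge>0. S t ` A = A) \<and>
     (\<forall>B. Metric_space.mbounded M d B \<and> (\<forall>t\<ge>0. S t ` B = B) \<longrightarrow> B \<subseteq> A) \<and>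
     (\<forall>B. Metric_space.mbounded M d B \<longrightarrow>
        ((\<lambda>t. SUP b\<in>B. INF y\<in>A. ennreal (d (S t b) y)) \<longlongrightarrow> 0) at_top)"

end

theory Submission
  imports Defs "HOL-Real_Asymp.Real_Asymp"
begin

text \<open>Since \<open>\<bar>J * (f \<circ> u) + h\<bar> \<le> r\<close>, the equation \<open>u' = -u + (J * (f \<circ> u) + h)\<close> contracts
  towards the band \<open>{\<bar>u\<bar> \<le> r}\<close>: the norm of \<open>max 0 (\<bar>u\<bar> - r)\<close> decays exponentially along solutions.
  To avoid integrating the equation in \<open>L\<^sup>p(\<rho>)\<close>, the decay is read off from the difference quotients.
  Each point of the attractor is \<open>S T Y\<close> for some \<open>Y\<close> in the attractor and every \<open>T\<close>, and the
  attractor is bounded, so letting \<open>T\<close> tend to infinity the excess over \<open>r\<close> vanishes. For the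
  exponent, the rate 1/2 instead of 1 suffices; it leaves room for the backward steps, where
  \<open>1 / (1 + d)\<close> exceeds \<open>exp (- d)\<close>.\<close>

section \<open>Convexity inequalities for real powers\<close>

text \<open>For positive \<open>x\<close> and \<open>y\<close> this is \<open>powr_convex\<close>.
  If one of them is 0, a single term survives and \<open>s powr p \<le> s\<close> on [0, 1] gives
  the claim.\<close>

lemma powr_convex_nonneg:
  fixes x y t p :: real
  assumes "1 \<le> p" "0 \<le> x" "0 \<le> y" "0 \<le> t" "t \<le> 1"
  shows "(t * x + (1 - t) * y) powr p \<le> t * x powr p + (1 - t) * y powr p"
proof -
  have scale: "(s * z) powr p \<le> s * z powr p" if "0 \<le> s" "s \<le> 1" "0 \<le> z" for s z :: real
  proof -
    have "s powr p \<le> s"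
      using powr_mono'[of 1 p s] that assms by simp
    then show ?thesis
      using that by (simp add: powr_mult mult_right_mono)
  qed
  show ?thesis
  proof (cases "x = 0 \<or> y = 0")
    case True
    then show ?thesis
      using scale[of t x] scale[of "1 - t" y] assms by auto
  next
    case False
    then show ?thesis
      using convex_onD[OF powr_convex[OF assms(1)], of "1 - t" x y] assms by simp
  qed
qed

text \<open>Convexity applied to \<open>\<bar>x\<bar> / \<alpha>\<close> and
  \<open>\<bar>y\<bar> / \<beta>\<close> with weights proportional to \<open>\<alpha>\<close> and
  \<open>\<beta>\<close>. Integrated with \<open>\<alpha>\<close>, \<open>\<beta>\<close> close to
  two norms, it becomes Minkowski's inequality.\<close>

lemma powr_add_le_weighted:
  fixes x y \<alpha> \<beta> p :: real
  assumes "1 \<le> p" "0 < \<alpha>" "0 < \<beta>"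
  shows "\<bar>x + y\<bar> powr p
    \<le> (\<alpha> + \<beta>) powr p * (\<alpha> / (\<alpha> + \<beta>) * (\<bar>x\<bar> powr p / \<alpha> powr p) + \<beta> / (\<alpha> + \<beta>) * (\<bar>y\<bar> powr p / \<beta> powr p))"
proof -
  let ?t = "\<alpha> / (\<alpha> + \<beta>)"
  have t: "0 \<le> ?t" "?t \<le> 1" "1 - ?t = \<beta> / (\<alpha> + \<beta>)"
    using assms by (auto simp: field_simps)
  have "(\<bar>x\<bar> + \<bar>y\<bar>) = (\<alpha> + \<beta>) * (?t * (\<bar>x\<bar> / \<alpha>) + (1 - ?t) * (\<bar>y\<bar> / \<beta>))"
    unfolding t(3) using assms by (simp add: divide_simps)
  then have "(\<bar>x\<bar> + \<bar>y\<bar>) powr p = (\<alpha> + \<beta>) powr p * (?t * (\<bar>x\<bar> / \<alpha>) + (1 - ?t) * (\<bar>y\<bar> / \<beta>)) powr p"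
    using assms t(1,2) by (simp add: powr_mult)
  also have "\<dots> \<le> (\<alpha> + \<beta>) powr p * (?t * (\<bar>x\<bar> / \<alpha>) powr p + (1 - ?t) * (\<bar>y\<bar> / \<beta>) powr p)"
    using assms t(1,2) by (intro mult_left_mono powr_convex_nonneg) auto
  also have "\<dots> = (\<alpha> + \<beta>) powr p * (?t * (\<bar>x\<bar> powr p / \<alpha> powr p) + (1 - ?t) * (\<bar>y\<bar> powr p / \<beta> powr p))"
    using assms by (simp add: powr_divide)
  finally have "(\<bar>x\<bar> + \<bar>y\<bar>) powr p \<le> \<dots>" .
  moreover have "\<bar>x + y\<bar> powr p \<le> (\<bar>x\<bar> + \<bar>y\<bar>) powr p"
    using assms by (intro powr_mono2) auto
  ultimately show ?thesis
    unfolding t(3) by linarith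
qed

section \<open>The weighted seminorm and Minkowski's inequality\<close>

locale weighted_Lp =
  fixes p :: real and \<rho> :: "real^'n \<Rightarrow> real"
  assumes p_gt_1: "1 < p"
    and weight_integrable: "integrable lebesgue \<rho>"
    and weight_pos: "\<And>x. 0 < \<rho> x"
begin

text \<open>Unlike \<open>Lp_fun\<close>, this space does not ask for local integrability; it only excludes the junk
  value 0 that \<open>Lp_norm\<close> takes on functions whose weighted power is not integrable.\<close>

definition Lp_finite :: "(real^'n \<Rightarrow> real) set" where
  "Lp_finite = {u \<in> borel_measurable lebesgue. integrable lebesgue (\<lambda>x. \<bar>u x\<bar> powr p * \<rho> x)}"

lemma weight_measurable [measurable]: "\<rho> \<in> borel_measurable lebesgue"
  using weight_integrable by auto

lemma Lp_finite_measurable [measurable_dest]: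
  "u \<in> Lp_finite \<Longrightarrow> u \<in> borel_measurable lebesgue"
  by (simp add: Lp_finite_def)

lemma Lp_finite_integrable:
  "u \<in> Lp_finite \<Longrightarrow> integrable lebesgue (\<lambda>x. \<bar>u x\<bar> powr p * \<rho> x)"
  by (simp add: Lp_finite_def)

lemma Lp_norm_nonneg [simp]: "0 \<le> Lp_norm p \<rho> u"
  by (simp add: Lp_norm_def)

lemma Lp_finite_mono:
  assumes "v \<in> Lp_finite" and [measurable]: "u \<in> borel_measurable lebesgue"
    and le: "\<And>x. \<bar>u x\<bar> \<le> \<bar>v x\<bar>"
  shows "u \<in> Lp_finite" and "Lp_norm p \<rho> u \<le> Lp_norm p \<rho> v"
proof -
  have *: "\<bar>u x\<bar> powr p * \<rho> x \<le> \<bar>v x\<bar> powr p * \<rho> x" for x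
    using le p_gt_1 weight_pos[of x] by (intro mult_right_mono powr_mono2) auto
  have "integrable lebesgue (\<lambda>x. \<bar>u x\<bar> powr p * \<rho> x)"
    by (rule Bochner_Integration.integrable_bound[OF Lp_finite_integrable[OF assms(1)]])
      (use * weight_pos in \<open>auto simp: less_imp_le\<close>)
  then show u: "u \<in> Lp_finite"
    by (simp add: Lp_finite_def)
  show "Lp_norm p \<rho> u \<le> Lp_norm p \<rho> v"
    unfolding Lp_norm_def
  proof (rule powr_mono2)
    show "(LINT x|lebesgue. \<bar>u x\<bar> powr p * \<rho> x) \<le> (LINT x|lebesgue. \<bar>v x\<bar> powr p * \<rho> x)"
      using u assms(1) * by (intro integral_mono Lp_finite_integrable)
  qed (use p_gt_1 weight_pos in \<open>auto intro!: integral_nonneg_AE simp: less_imp_le\<close>)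
qed

text \<open>The integrable weight defines a finite measure, so constants belong to the space. This
  admits the bounded part of the vector field, the convolution plus \<open>h\<close>.\<close>

lemma Lp_finite_bounded:
  assumes [measurable]: "u \<in> borel_measurable lebesgue" and "\<And>x. \<bar>u x\<bar> \<le> c"
  shows "u \<in> Lp_finite"
proof -
  have "integrable lebesgue (\<lambda>x. \<bar>u x\<bar> powr p * \<rho> x)"
  proof (rule Bochner_Integration.integrable_bound)
    show "integrable lebesgue (\<lambda>x. c powr p * \<rho> x)"
      using weight_integrable by simp
    show "AE x in lebesgue. norm (\<bar>u x\<bar> powr p * \<rho> x) \<le> norm (c powr p * \<rho> x)"
      using assms(2) p_gt_1 weight_pos
      by (auto intro!: AE_I2 mult_mono powr_mono2 simp: abs_mult less_imp_le)
  qed simp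
  then show ?thesis
    by (simp add: Lp_finite_def)
qed

lemma Lp_finite_scale:
  assumes "u \<in> Lp_finite"
  shows "(\<lambda>x. c * u x) \<in> Lp_finite" and "Lp_norm p \<rho> (\<lambda>x. c * u x) = \<bar>c\<bar> * Lp_norm p \<rho> u"
proof -
  have [measurable]: "u \<in> borel_measurable lebesgue"
    using assms by measurable
  have eq: "\<bar>c * u x\<bar> powr p * \<rho> x = \<bar>c\<bar> powr p * (\<bar>u x\<bar> powr p * \<rho> x)" for x
    by (simp add: abs_mult powr_mult)
  show "(\<lambda>x. c * u x) \<in> Lp_finite"
    using Lp_finite_integrable[OF assms] by (simp add: Lp_finite_def eq)
  have "0 \<le> (LINT x|lebesgue. \<bar>u x\<bar> powr p * \<rho> x)"
    using weight_pos by (auto intro!: integral_nonneg_AE simp: less_imp_le)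
  then show "Lp_norm p \<rho> (\<lambda>x. c * u x) = \<bar>c\<bar> * Lp_norm p \<rho> u"
    using p_gt_1 by (simp add: Lp_norm_def eq powr_mult powr_powr)
qed

lemma Lp_norm_powr:
  "(LINT x|lebesgue. \<bar>u x\<bar> powr p * \<rho> x) = Lp_norm p \<rho> u powr p"
proof -
  have "0 \<le> (LINT x|lebesgue. \<bar>u x\<bar> powr p * \<rho> x)"
    using weight_pos by (auto intro!: integral_nonneg_AE simp: less_imp_le)
  then show ?thesis
    using p_gt_1 by (simp add: Lp_norm_def powr_powr)
qed

text \<open>Minkowski's inequality by normalisation: for \<open>\<alpha>\<close>,
  \<open>\<beta>\<close> above the norms of \<open>u\<close> and \<open>v\<close>, the weighted
  integrals of \<open>\<bar>u x\<bar> powr p / \<alpha> powr p\<close> and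
  \<open>\<bar>v x\<bar> powr p / \<beta> powr p\<close> are at most 1, so
  \<open>powr_add_le_weighted\<close> integrates to at most
  \<open>(\<alpha> + \<beta>) powr p\<close>. Then \<open>\<alpha>\<close>, \<open>\<beta>\<close>
  decrease to the norms.\<close>

lemma Lp_finite_add:
  assumes u: "u \<in> Lp_finite" and v: "v \<in> Lp_finite"
  shows "(\<lambda>x. u x + v x) \<in> Lp_finite"
    and "Lp_norm p \<rho> (\<lambda>x. u x + v x) \<le> Lp_norm p \<rho> u + Lp_norm p \<rho> v"
proof -
  have [measurable]: "u \<in> borel_measurable lebesgue" "v \<in> borel_measurable lebesgue"
    using u v by measurable
  note int = Lp_finite_integrable[OF u] Lp_finite_integrable[OF v]
  define B where "B \<alpha> \<beta> x = (\<alpha> + \<beta>) powr p * (\<alpha> / (\<alpha> + \<beta>) / \<alpha> powr p * (\<bar>u x\<bar> powr p * \<rho> x)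
      + \<beta> / (\<alpha> + \<beta>) / \<beta> powr p * (\<bar>v x\<bar> powr p * \<rho> x))" for \<alpha> \<beta> :: real and x
  have le: "\<bar>u x + v x\<bar> powr p * \<rho> x \<le> B \<alpha> \<beta> x" if "0 < \<alpha>" "0 < \<beta>" for \<alpha> \<beta> x
  proof -
    have "\<bar>u x + v x\<bar> powr p * \<rho> x \<le> ((\<alpha> + \<beta>) powr p * (\<alpha> / (\<alpha> + \<beta>) * (\<bar>u x\<bar> powr p / \<alpha> powr p)
        + \<beta> / (\<alpha> + \<beta>) * (\<bar>v x\<bar> powr p / \<beta> powr p))) * \<rho> x"
      using that p_gt_1 weight_pos[of x] by (intro mult_right_mono powr_add_le_weighted) auto
    also have "\<dots> = B \<alpha> \<beta> x"
      by (simp add: B_def algebra_simps)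
    finally show ?thesis .
  qed
  have B_int: "integrable lebesgue (B \<alpha> \<beta>)" for \<alpha> \<beta>
    unfolding B_def using int by simp
  \<comment> \<open>Any fixed positive weights give an integrable majorant; 1 and 1 are the
    simplest.\<close>
  have sum_int: "integrable lebesgue (\<lambda>x. \<bar>u x + v x\<bar> powr p * \<rho> x)"
    by (rule Bochner_Integration.integrable_bound[OF B_int[of 1 1]])
      (use le[of 1 1] weight_pos in \<open>auto intro!: AE_I2 simp: less_imp_le intro: order_trans[OF _ abs_ge_self]\<close>)
  then show mem: "(\<lambda>x. u x + v x) \<in> Lp_finite"
    by (simp add: Lp_finite_def)
  have main: "Lp_norm p \<rho> (\<lambda>x. u x + v x) \<le> \<alpha> + \<beta>"
    if \<alpha>: "Lp_norm p \<rho> u < \<alpha>" and \<beta>: "Lp_norm p \<rho> v < \<beta>" for \<alpha> \<beta>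
  proof -
    \<comment> \<open>Strict bounds keep \<open>\<alpha>\<close> and \<open>\<beta>\<close> positive
      even if a norm is 0.\<close>
    have pos: "0 < \<alpha>" "0 < \<beta>"
      using \<alpha> \<beta> Lp_norm_nonneg[of u] Lp_norm_nonneg[of v] by linarith+
    have "Lp_norm p \<rho> (\<lambda>x. u x + v x) powr p \<le> (LINT x|lebesgue. B \<alpha> \<beta> x)"
      unfolding Lp_norm_powr[symmetric] by (intro integral_mono sum_int B_int le pos)
    also have "\<dots> = (\<alpha> + \<beta>) powr p * (\<alpha> / (\<alpha> + \<beta>) / \<alpha> powr p * (Lp_norm p \<rho> u powr p)
      + \<beta> / (\<alpha> + \<beta>) / \<beta> powr p * (Lp_norm p \<rho> v powr p))"
      unfolding B_def Lp_norm_powr[symmetric] using int by simp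
    also have "\<dots> \<le> (\<alpha> + \<beta>) powr p * (\<alpha> / (\<alpha> + \<beta>) / \<alpha> powr p * \<alpha> powr p
      + \<beta> / (\<alpha> + \<beta>) / \<beta> powr p * \<beta> powr p)"
      using \<alpha> \<beta> pos p_gt_1 by (intro mult_left_mono add_mono powr_mono2) auto
    also have "\<dots> = (\<alpha> + \<beta>) powr p"
      using pos by (simp add: add_divide_distrib[symmetric])
    finally show ?thesis
      using p_gt_1 pos powr_less_mono2[of p "\<alpha> + \<beta>" "Lp_norm p \<rho> (\<lambda>x. u x + v x)"]
      by (smt (verit))
  qed
  show "Lp_norm p \<rho> (\<lambda>x. u x + v x) \<le> Lp_norm p \<rho> u + Lp_norm p \<rho> v"
  proof (rule field_le_epsilon)
    fix e :: real assume "0 < e"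
    then show "Lp_norm p \<rho> (\<lambda>x. u x + v x) \<le> Lp_norm p \<rho> u + Lp_norm p \<rho> v + e"
      using main[of "Lp_norm p \<rho> u + e / 2" "Lp_norm p \<rho> v + e / 2"] by simp
  qed
qed

lemma Lp_finite_diff:
  assumes "u \<in> Lp_finite" "v \<in> Lp_finite"
  shows "(\<lambda>x. u x - v x) \<in> Lp_finite"
  using Lp_finite_add(1)[OF assms(1) Lp_finite_scale(1)[OF assms(2), of "-1"]] by simp

lemma Lp_norm_eq_0_AE:
  assumes u: "u \<in> Lp_finite" and "Lp_norm p \<rho> u = 0"
  shows "AE x in lebesgue. u x = 0"
proof -
  have "(LINT x|lebesgue. \<bar>u x\<bar> powr p * \<rho> x) = 0"
    using assms(2) p_gt_1 by (simp add: Lp_norm_powr)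
  then have "AE x in lebesgue. \<bar>u x\<bar> powr p * \<rho> x = 0"
    using integral_nonneg_eq_0_iff_AE[OF Lp_finite_integrable[OF u]] weight_pos
    by (simp add: less_imp_le)
  then show ?thesis
    by eventually_elim (use weight_pos in \<open>auto simp: less_le\<close>)
qed

lemma Lp_norm_cong_AE:
  assumes [measurable]: "u \<in> borel_measurable lebesgue" "v \<in> borel_measurable lebesgue"
    and "AE x in lebesgue. u x = v x"
  shows "Lp_norm p \<rho> u = Lp_norm p \<rho> v"
proof -
  have "(LINT x|lebesgue. \<bar>u x\<bar> powr p * \<rho> x) = (LINT x|lebesgue. \<bar>v x\<bar> powr p * \<rho> x)"
    using assms(3) by (intro integral_cong_AE) auto
  then show ?thesis
    by (simp add: Lp_norm_def)
qed

section \<open>From functions to classes, and the metric\<close>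

text \<open>Measurability comes from local integrability: \<open>u\<close> is the pointwise limit of
  its truncations to balls, each integrable over the whole space.\<close>

lemma Lp_fun_subset: "Lp_fun p \<rho> \<subseteq> Lp_finite"
proof
  fix u assume u: "u \<in> Lp_fun p \<rho>"
  have "u \<in> borel_measurable lebesgue"
  proof (rule borel_measurable_LIMSEQ_real)
    show "(\<lambda>n. indicat_real (cball 0 (real n)) x * u x) \<longlonglongrightarrow> u x" for x
    proof (rule tendsto_eventually)
      obtain m where "norm x \<le> real m"
        using real_arch_simple by blast
      then have "\<forall>n\<ge>m. indicat_real (cball 0 (real n)) x * u x = u x"
        by (auto simp: indicator_def)
      then show "\<forall>\<^sub>F n in sequentially. indicat_real (cball 0 (real n)) x * u x = u x"
        by (auto simp: eventually_sequentially)
    qed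
    show "(\<lambda>x. indicat_real (cball 0 (real n)) x * u x) \<in> borel_measurable lebesgue" for n
    proof -
      have "u absolutely_integrable_on cball 0 (real n)"
        using u by (simp add: Lp_fun_def locally_integrable_def)
      then show ?thesis
        by (auto simp: set_integrable_def dest: borel_measurable_integrable)
    qed
  qed
  then show "u \<in> Lp_finite"
    using u by (simp add: Lp_fun_def Lp_finite_def)
qed

lemma equiv_AE_eq:
  "equiv (Lp_fun p \<rho>) {(u, v). u \<in> Lp_fun p \<rho> \<and> v \<in> Lp_fun p \<rho> \<and> (AE x in lebesgue. u x = v x)}"
proof (rule equivI)
  show "trans {(u, v). u \<in> Lp_fun p \<rho> \<and> v \<in> Lp_fun p \<rho> \<and> (AE x in lebesgue. u x = v x)}"
    by (rule transI) (auto elim: AE_mp)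
  show "sym {(u, v). u \<in> Lp_fun p \<rho> \<and> v \<in> Lp_fun p \<rho> \<and> (AE x in lebesgue. u x = v x)}"
    by (rule symI) (auto simp: eq_commute)
qed (auto simp: refl_on_def)

lemma Lp_rep_in:
  assumes "X \<in> Lp p \<rho>"
  shows "Lp_rep X \<in> X"
  using in_quotient_imp_non_empty[OF equiv_AE_eq assms[unfolded Lp_def]]
  by (simp add: Lp_rep_def some_in_eq)

lemma Lp_rep_finite:
  assumes "X \<in> Lp p \<rho>"
  shows "Lp_rep X \<in> Lp_finite"
  using Lp_rep_in[OF assms] in_quotient_imp_subset[OF equiv_AE_eq assms[unfolded Lp_def]] Lp_fun_subset
  by blast

lemma Lp_eq_iff_AE:
  assumes "X \<in> Lp p \<rho>" "Y \<in> Lp p \<rho>" "u \<in> X" "v \<in> Y"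
  shows "X = Y \<longleftrightarrow> (AE x in lebesgue. u x = v x)"
proof -
  have "u \<in> Lp_fun p \<rho>" "v \<in> Lp_fun p \<rho>"
    using assms in_quotient_imp_subset[OF equiv_AE_eq] unfolding Lp_def by blast+
  then show ?thesis
    using quotient_eq_iff[OF equiv_AE_eq assms(1,2)[unfolded Lp_def] assms(3,4)] by simp
qed

text \<open>Opens the theory of metric spaces for the attractor, in particular that compact sets are
  bounded. Points separate because they are classes modulo null sets.\<close>

lemma Metric_space_Lp: "Metric_space (Lp p \<rho>) (Lp_dist p \<rho>)"
proof
  fix X Y Z :: "(real^'n \<Rightarrow> real) set"
  show "0 \<le> Lp_dist p \<rho> X Y"
    by (simp add: Lp_dist_def)
  show "Lp_dist p \<rho> X Y = Lp_dist p \<rho> Y X"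
    by (simp add: Lp_dist_def Lp_norm_def abs_minus_commute)
  assume X: "X \<in> Lp p \<rho>" and Y: "Y \<in> Lp p \<rho>"
  note rX = Lp_rep_finite[OF X] and rY = Lp_rep_finite[OF Y]
  have [measurable]: "Lp_rep X \<in> borel_measurable lebesgue" "Lp_rep Y \<in> borel_measurable lebesgue"
    using rX rY by measurable
  have zero: "Lp_norm p \<rho> (\<lambda>x. 0) = 0"
    using p_gt_1 by (simp add: Lp_norm_def)
  have "Lp_dist p \<rho> X Y = 0 \<longleftrightarrow> (AE x in lebesgue. Lp_rep X x = Lp_rep Y x)"
  proof
    assume "Lp_dist p \<rho> X Y = 0"
    then show "AE x in lebesgue. Lp_rep X x = Lp_rep Y x"
      using Lp_norm_eq_0_AE[OF Lp_finite_diff[OF rX rY]] by (simp add: Lp_dist_def)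
  next
    assume "AE x in lebesgue. Lp_rep X x = Lp_rep Y x"
    then have "Lp_dist p \<rho> X Y = Lp_norm p \<rho> (\<lambda>x. 0)"
      unfolding Lp_dist_def by (intro Lp_norm_cong_AE) auto
    then show "Lp_dist p \<rho> X Y = 0"
      using zero by simp
  qed
  then show "Lp_dist p \<rho> X Y = 0 \<longleftrightarrow> X = Y"
    using Lp_eq_iff_AE[OF X Y Lp_rep_in[OF X] Lp_rep_in[OF Y]] by simp
  assume Z: "Z \<in> Lp p \<rho>"
  show "Lp_dist p \<rho> X Z \<le> Lp_dist p \<rho> X Y + Lp_dist p \<rho> Y Z"
    using Lp_finite_add(2)[OF Lp_finite_diff[OF rX rY] Lp_finite_diff[OF rY Lp_rep_finite[OF Z]]]
    by (simp add: Lp_dist_def)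
qed

section \<open>The excess over the band and one-step estimates\<close>

text \<open>For \<open>0 \<le> r\<close> the function under the norm is the distance of
  \<open>u x\<close> from the interval [-r, r].\<close>

definition excess :: "real \<Rightarrow> (real^'n \<Rightarrow> real) \<Rightarrow> real" where
  "excess r u = Lp_norm p \<rho> (\<lambda>x. max 0 (\<bar>u x\<bar> - r))"

lemma excess_finite:
  assumes "u \<in> Lp_finite" "0 \<le> r"
  shows "(\<lambda>x. max 0 (\<bar>u x\<bar> - r)) \<in> Lp_finite" and "excess r u \<le> Lp_norm p \<rho> u"
proof -
  have [measurable]: "u \<in> borel_measurable lebesgue"
    using assms by measurable
  have "\<bar>max 0 (\<bar>u x\<bar> - r)\<bar> \<le> \<bar>u x\<bar>" for x
    using assms by auto
  then show "(\<lambda>x. max 0 (\<bar>u x\<bar> - r)) \<in> Lp_finite" "excess r u \<le> Lp_norm p \<rho> u"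
    unfolding excess_def by (auto intro!: Lp_finite_mono[OF assms(1)])
qed

text \<open>Common to both time directions: a pointwise estimate with an error \<open>q\<close> of
  arbitrary sign passes to norms by monotonicity and Minkowski's inequality.\<close>

lemma excess_step:
  assumes u: "u \<in> Lp_finite" and v: "v \<in> Lp_finite" and q: "q \<in> Lp_finite"
    and "0 \<le> r" "0 \<le> c" "0 \<le> d"
    and le: "\<And>x. max 0 (\<bar>v x\<bar> - r) \<le> c * max 0 (\<bar>u x\<bar> - r) + d * \<bar>q x\<bar>"
  shows "excess r v \<le> c * excess r u + d * Lp_norm p \<rho> q"
proof -
  have [measurable]: "q \<in> borel_measurable lebesgue" "v \<in> borel_measurable lebesgue"
    using q v by measurable
  note fu = excess_finite(1)[OF u \<open>0 \<le> r\<close>]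
  have aq: "(\<lambda>x. \<bar>q x\<bar>) \<in> Lp_finite"
    by (rule Lp_finite_mono[OF q]) auto
  have naq: "Lp_norm p \<rho> (\<lambda>x. \<bar>q x\<bar>) = Lp_norm p \<rho> q"
    by (simp add: Lp_norm_def)
  have "excess r v \<le> Lp_norm p \<rho> (\<lambda>x. c * max 0 (\<bar>u x\<bar> - r) + d * \<bar>q x\<bar>)"
    unfolding excess_def
    by (rule Lp_finite_mono(2)[OF Lp_finite_add(1)[OF Lp_finite_scale(1)[OF fu] Lp_finite_scale(1)[OF aq]]])
      (use le in \<open>auto intro: order_trans[OF _ abs_ge_self]\<close>)
  also have "\<dots> \<le> Lp_norm p \<rho> (\<lambda>x. c * max 0 (\<bar>u x\<bar> - r)) + Lp_norm p \<rho> (\<lambda>x. d * \<bar>q x\<bar>)"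
    by (rule Lp_finite_add(2)[OF Lp_finite_scale(1)[OF fu] Lp_finite_scale(1)[OF aq]])
  also have "\<dots> = c * excess r u + d * Lp_norm p \<rho> q"
    unfolding Lp_finite_scale(2)[OF fu] Lp_finite_scale(2)[OF aq] naq
    using assms by (simp add: excess_def)
  finally show ?thesis .
qed

lemma excess_eq_0_AE:
  assumes "u \<in> Lp_finite" "0 \<le> r" "excess r u = 0"
  shows "AE x in lebesgue. \<bar>u x\<bar> \<le> r"
  using Lp_norm_eq_0_AE[OF excess_finite(1)[OF assms(1,2)]] assms(3)
  by (auto simp: excess_def elim!: AE_mp)

text \<open>An explicit Euler step of length \<open>d\<close> with residual \<open>q\<close>:
  \<open>v x\<close> is the convex combination \<open>(1 - d) * u x + d * g x\<close> plus an error,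
  and averaging with a value in [-r, r] shrinks the excess by the factor
  \<open>1 - d\<close>.\<close>

lemma excess_forward_step:
  assumes u: "u \<in> Lp_finite" and v: "v \<in> Lp_finite" and q: "q \<in> Lp_finite"
    and g: "\<And>x. \<bar>g x\<bar> \<le> r" and d: "0 \<le> d" "d \<le> 1"
    and v_eq: "\<And>x. v x = u x + d * (- u x + g x + q x)"
  shows "excess r v \<le> exp (- (d / 2)) * excess r u + d * Lp_norm p \<rho> q"
proof -
  have r: "0 \<le> r"
    using g[of undefined] by simp
  have le: "max 0 (\<bar>v x\<bar> - r) \<le> (1 - d) * max 0 (\<bar>u x\<bar> - r) + d * \<bar>q x\<bar>" for x
  proof -
    have "\<bar>v x\<bar> = \<bar>(1 - d) * u x + d * g x + d * q x\<bar>"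
      by (simp add: v_eq algebra_simps)
    also have "\<dots> \<le> \<bar>(1 - d) * u x\<bar> + \<bar>d * g x\<bar> + \<bar>d * q x\<bar>"
      by linarith
    also have "\<dots> = (1 - d) * \<bar>u x\<bar> + d * \<bar>g x\<bar> + d * \<bar>q x\<bar>"
      using d by (simp add: abs_mult)
    also have "\<dots> \<le> (1 - d) * \<bar>u x\<bar> + d * r + d * \<bar>q x\<bar>"
      using d g by (simp add: mult_left_mono)
    finally have "\<bar>v x\<bar> - r \<le> (1 - d) * (\<bar>u x\<bar> - r) + d * \<bar>q x\<bar>"
      by (simp add: algebra_simps)
    also have "\<dots> \<le> (1 - d) * max 0 (\<bar>u x\<bar> - r) + d * \<bar>q x\<bar>"
      using d by (intro add_right_mono mult_left_mono) auto
    finally show ?thesis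
      using d by auto
  qed
  have "excess r v \<le> (1 - d) * excess r u + d * Lp_norm p \<rho> q"
    by (rule excess_step[OF u v q r _ _ le]) (use d in auto)
  moreover have "1 - d \<le> exp (- (d / 2))"
    using exp_ge_add_one_self[of "- (d / 2)"] d by simp
  ultimately show ?thesis
    using mult_right_mono[of "1 - d" "exp (- (d / 2))" "excess r u"]
    by (simp add: excess_def)
qed

text \<open>An implicit Euler step: the slope is taken at the endpoint \<open>v\<close>. Solving for
  it gives \<open>(1 + d) * v x = u x + d * g x + d * q x\<close>, so the excess shrinks by the
  factor \<open>1 / (1 + d)\<close>.\<close>

lemma excess_backward_step:
  assumes u: "u \<in> Lp_finite" and v: "v \<in> Lp_finite" and q: "q \<in> Lp_finite"
    and g: "\<And>x. \<bar>g x\<bar> \<le> r" and d: "0 \<le> d" "d \<le> 1"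
    and u_eq: "\<And>x. u x = v x - d * (- v x + g x + q x)"
  shows "excess r v \<le> exp (- (d / 2)) * excess r u + d * Lp_norm p \<rho> q"
proof -
  have r: "0 \<le> r"
    using g[of undefined] by simp
  have le: "max 0 (\<bar>v x\<bar> - r) \<le> (1 / (1 + d)) * max 0 (\<bar>u x\<bar> - r) + d * \<bar>q x\<bar>" for x
  proof -
    have "(1 + d) * \<bar>v x\<bar> = \<bar>(1 + d) * v x\<bar>"
      using d by (simp add: abs_mult)
    also have "\<dots> = \<bar>u x + d * g x + d * q x\<bar>"
      by (simp add: u_eq algebra_simps)
    also have "\<dots> \<le> \<bar>u x\<bar> + \<bar>d * g x\<bar> + \<bar>d * q x\<bar>"
      by linarith
    also have "\<dots> \<le> \<bar>u x\<bar> + d * r + d * \<bar>q x\<bar>"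
      using d g by (simp add: mult_left_mono abs_mult)
    \<comment> \<open>The error is enlarged by \<open>1 + d\<close> so that division by
      \<open>1 + d\<close> leaves exactly \<open>d * \<bar>q x\<bar>\<close>.\<close>
    also have "d * \<bar>q x\<bar> \<le> (1 + d) * (d * \<bar>q x\<bar>)"
      using d by (simp add: algebra_simps)
    finally have "(1 + d) * (\<bar>v x\<bar> - r - d * \<bar>q x\<bar>) \<le> \<bar>u x\<bar> - r"
      by (simp add: algebra_simps)
    also have "\<dots> \<le> max 0 (\<bar>u x\<bar> - r)"
      by simp
    finally have "(1 + d) * (\<bar>v x\<bar> - r - d * \<bar>q x\<bar>) \<le> max 0 (\<bar>u x\<bar> - r)" .
    then have "\<bar>v x\<bar> - r - d * \<bar>q x\<bar> \<le> max 0 (\<bar>u x\<bar> - r) / (1 + d)"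
      using d by (simp add: pos_le_divide_eq mult.commute)
    then show ?thesis
      using d by auto
  qed
  have "excess r v \<le> (1 / (1 + d)) * excess r u + d * Lp_norm p \<rho> q"
    by (rule excess_step[OF u v q r _ _ le]) (use d in auto)
  moreover have "1 / (1 + d) \<le> exp (- (d / 2))"
  proof -
    \<comment> \<open>This is \<open>exp z \<le> 1 + 2 * z\<close> at \<open>z = d / 2\<close>,
      valid up to 1/2; hence the rate 1/2 and the condition \<open>d \<le> 1\<close>.\<close>
    have "exp (d / 2) \<le> 1 + d"
      using exp_bound_half[of "d / 2"] exp_bound_lemma[of "d / 2"] d by simp
    then show ?thesis
      using d by (simp add: exp_minus field_simps)
  qed
  ultimately show ?thesis
    using mult_right_mono[of "1 / (1 + d)" "exp (- (d / 2))" "excess r u"]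
    by (simp add: excess_def)
qed

end

section \<open>Bounds and measurability of the convolution\<close>

text \<open>Evenness turns \<open>x - y\<close> into \<open>- x + y\<close>, and Lebesgue measure is
  translation invariant. Borel measurability of \<open>J\<close> allows the change from
  \<open>lebesgue\<close> to \<open>lborel\<close>.\<close>

lemma integral_reflect_translate:
  fixes J :: "'a::euclidean_space \<Rightarrow> real"
  assumes "J \<in> borel_measurable borel" and even: "\<And>x. J (- x) = J x"
  shows "(LINT y|lebesgue. J (x - y)) = (LINT y|lebesgue. J y)"
proof -
  have [measurable]: "J \<in> borel_measurable lborel"
    using assms(1) by simp
  have "(LINT y|lebesgue. J (x - y)) = (LINT y|lborel. J (- x + y))"
    using even[of "x - _"] by (subst integral_completion) (auto simp: add.commute)
  also have "\<dots> = (LINT y|distr lborel borel ((+) (- x)). J y)"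
    using assms(1) by (subst integral_distr) auto
  also have "\<dots> = (LINT y|lebesgue. J y)"
    by (simp only: lborel_distr_plus) (simp add: integral_completion)
  finally show ?thesis .
qed

text \<open>\<open>w\<close> stands for \<open>f \<circ> u\<close> at one fixed time.\<close>

locale bounded_kernel =
  fixes J w :: "real^'n \<Rightarrow> real" and a :: real
  assumes J_cont: "continuous_on UNIV J"
    and J_nonneg: "\<And>x. 0 \<le> J x"
    and J_even: "\<And>x. J (- x) = J x"
    and J_supp: "\<And>x. J x \<noteq> 0 \<Longrightarrow> norm x \<le> 1"
    and w_measurable [measurable]: "w \<in> borel_measurable lebesgue"
    and w_bound: "\<And>x. \<bar>w x\<bar> \<le> a"
begin

lemma J_bounded: obtains B where "\<And>x. J x \<le> B" "0 \<le> B"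
proof -
  have "compact (J ` cball 0 1)"
    using J_cont by (intro compact_continuous_image continuous_on_subset[OF J_cont]) auto
  then obtain B where B: "\<And>x. norm x \<le> 1 \<Longrightarrow> \<bar>J x\<bar> \<le> B"
    by (force dest: compact_imp_bounded simp: bounded_iff)
  have "J x \<le> B" for x
    using B[of x] B[of 0] J_supp[of x] by (cases "J x = 0") auto
  moreover have "0 \<le> B"
    using B[of 0] by simp
  ultimately show thesis
    using that by blast
qed

lemma J_borel: "J \<in> borel_measurable borel"
  using J_cont by (rule borel_measurable_continuous_onI)

lemma J_translate_measurable [measurable]: "(\<lambda>y. J (x - y)) \<in> borel_measurable lebesgue"
proof -
  have "(\<lambda>y. J (x - y)) \<in> borel_measurable borel"
    using J_borel by measurable
  then show ?thesis
    by (simp add: measurable_completion)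
qed

lemma integrable_indicator_cball: "integrable lebesgue (\<lambda>y. c * indicat_real (cball (x::real^'n) R) y)"
  using lmeasurable_cball[of x R] by (auto simp: fmeasurable_def)

lemma J_translate_integrable: "integrable lebesgue (\<lambda>y. J (x - y))"
proof -
  obtain B where B: "\<And>x. J x \<le> B" "0 \<le> B"
    using J_bounded by blast
  show ?thesis
  proof (rule Bochner_Integration.integrable_bound)
    show "integrable lebesgue (\<lambda>y. B * indicat_real (cball x 1) y)"
      by (rule integrable_indicator_cball)
    show "AE y in lebesgue. norm (J (x - y)) \<le> norm (B * indicat_real (cball x 1) y)"
    proof (rule AE_I2)
      fix y
      show "norm (J (x - y)) \<le> norm (B * indicat_real (cball x 1) y)"
        using B(2) B(1)[of "x - y"] J_supp[of "x - y"] J_nonneg[of "x - y"]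
        by (auto simp: indicator_def dist_norm)
    qed
  qed simp
qed

text \<open>The bound \<open>a\<close> leaves the integral, and the mass of the reflected,
  translated kernel does not depend on \<open>x\<close>. Adding \<open>h\<close> produces the radius
  \<open>r\<close>.\<close>

lemma convol_bound: "\<bar>convol J w x\<bar> \<le> a * (LINT y|lebesgue. \<bar>J y\<bar>)"
proof -
  have "\<bar>convol J w x\<bar> \<le> (LINT y|lebesgue. \<bar>J (x - y) * w y\<bar>)"
    unfolding convol_def by (rule integral_abs_bound)
  also have "\<dots> \<le> (LINT y|lebesgue. a * J (x - y))"
  proof (rule integral_mono')
    show "integrable lebesgue (\<lambda>y. a * J (x - y))"
      using J_translate_integrable by simp
    show "\<bar>J (x - y) * w y\<bar> \<le> a * J (x - y)" for y
      using mult_left_mono[OF w_bound[of y] J_nonneg[of "x - y"]] J_nonneg[of "x - y"]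
      by (simp add: abs_mult mult.commute)
    show "0 \<le> a * J (x - y)" for y
      using w_bound[of y] J_nonneg[of "x - y"] by simp
  qed
  also have "\<dots> = a * (LINT y|lebesgue. \<bar>J y\<bar>)"
    using J_nonneg by (simp add: integral_reflect_translate[OF J_borel J_even])
  finally show ?thesis .
qed

text \<open>Serves to make the convolution measurable. A convergent sequence stays in a ball of
  radius \<open>R\<close>, so all integrands are supported in the ball of radius
  \<open>R + 1\<close> and bounded by \<open>B * a\<close>; dominated convergence applies.\<close>

lemma convol_continuous: "continuous_on UNIV (convol J w)"
proof (intro continuous_at_imp_continuous_on ballI continuous_at_sequentiallyI)
  fix x :: "real^'n" and X assume X: "X \<longlonglongrightarrow> x"
  obtain B where B: "\<And>x. J x \<le> B" "0 \<le> B"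
    using J_bounded by blast
  obtain R where R: "\<And>n. norm (X n) \<le> R"
    using convergent_imp_Bseq[OF convergentI[OF X]] by (auto simp: Bseq_def)
  have a: "0 \<le> a"
    using w_bound[of 0] by simp
  show "(\<lambda>n. convol J w (X n)) \<longlonglongrightarrow> convol J w x"
    unfolding convol_def
  proof (rule integral_dominated_convergence)
    show "integrable lebesgue (\<lambda>y::real^'n. (B * a) * indicat_real (cball 0 (R + 1)) y)"
      by (rule integrable_indicator_cball)
    show "AE y in lebesgue. (\<lambda>n. J (X n - y) * w y) \<longlonglongrightarrow> J (x - y) * w y"
    proof (rule AE_I2)
      fix y
      have "(\<lambda>n. J (X n - y)) \<longlonglongrightarrow> J (x - y)"
        by (rule continuous_on_tendsto_compose[OF J_cont]) (auto intro!: tendsto_intros X)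
      then show "(\<lambda>n. J (X n - y) * w y) \<longlonglongrightarrow> J (x - y) * w y"
        by (intro tendsto_intros)
    qed
    show "AE y in lebesgue. norm (J (X n - y) * w y) \<le> (B * a) * indicat_real (cball 0 (R + 1)) y" for n
    proof (rule AE_I2)
      fix y
      show "norm (J (X n - y) * w y) \<le> (B * a) * indicat_real (cball 0 (R + 1)) y"
      proof (cases "J (X n - y) = 0")
        case True
        then show ?thesis
          using B(2) a by simp
      next
        case False
        then have "norm y \<le> R + 1"
          using J_supp[OF False] R[of n] norm_triangle_ineq4[of "X n" "X n - y"] by simp
        then show ?thesis
          using mult_mono[OF B(1)[of "X n - y"] w_bound[of y]] B(2) J_nonneg[of "X n - y"]
          by (simp add: abs_mult)
      qed
    qed
  qed measurable
qed

lemma convol_measurable: "convol J w \<in> borel_measurable lebesgue"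
  using borel_measurable_continuous_onI[OF convol_continuous] by (simp add: measurable_completion)

end

section \<open>Exponential decay of the excess along solutions\<close>

context weighted_Lp
begin

text \<open>For each \<open>e > 0\<close>, the bound with an additional \<open>e (t - s)\<close> can be chained over adjacent
  intervals, so it only has to be checked on short intervals around each time.\<close>

lemma excess_decay:
  fixes v g :: "real \<Rightarrow> real^'n \<Rightarrow> real"
  assumes v: "\<And>t. 0 \<le> t \<Longrightarrow> v t \<in> Lp_finite"
    and g_meas: "\<And>t. 0 \<le> t \<Longrightarrow> g t \<in> borel_measurable lebesgue"
    and g: "\<And>t x. 0 \<le> t \<Longrightarrow> \<bar>g t x\<bar> \<le> r"
    and deriv: "\<And>t. 0 \<le> t \<Longrightarrow>
      ((\<lambda>s. Lp_norm p \<rho> (\<lambda>x. (v s x - v t x) / (s - t) - (- v t x + g t x))) \<longlongrightarrow> 0) (at t within {0..})"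
    and T: "0 \<le> T"
  shows "excess r (v T) \<le> exp (- (T / 2)) * excess r (v 0)"
proof -
  define q where "q s t x = (v s x - v t x) / (s - t) - (- v t x + g t x)" for s t x
  \<comment> \<open>Membership ensures that a small \<open>Lp_norm\<close> of the residual is not
    the junk value 0. For \<open>s = t\<close> the quotient is 0, so no case distinction
    arises.\<close>
  have q: "q s t \<in> Lp_finite" if "0 \<le> s" "0 \<le> t" for s t
  proof -
    have "(\<lambda>x. (1 / (s - t)) * (v s x - v t x) - ((-1) * v t x + g t x)) \<in> Lp_finite"
      using that
      by (intro Lp_finite_diff Lp_finite_add Lp_finite_scale v Lp_finite_bounded[OF g_meas g])
    then show ?thesis
      by (simp add: q_def[abs_def])
  qed
  have approx: "excess r (v T) \<le> exp (- ((T - 0) / 2)) * excess r (v 0) + e * (T - 0)" if e: "0 < e" for e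
  proof -
    \<comment> \<open>The guard \<open>0 \<le> s\<close> is part of \<open>P\<close> because the
      local case of \<open>Bolzano\<close> also ranges over intervals that start below 0.\<close>
    define P where "P s t \<longleftrightarrow> (0 \<le> s \<longrightarrow> excess r (v t) \<le> exp (- ((t - s) / 2)) * excess r (v s) + e * (t - s))"
      for s t
    have P_trans: "P s u" if "P s t" "P t u" "s \<le> t" "t \<le> u" for s t u
      unfolding P_def
    proof
      assume s: "0 \<le> s"
      have "excess r (v u) \<le> exp (- ((u - t) / 2)) * excess r (v t) + e * (u - t)"
        using that s by (auto simp: P_def)
      also have "\<dots> \<le> exp (- ((u - t) / 2)) * (exp (- ((t - s) / 2)) * excess r (v s) + e * (t - s)) + e * (u - t)"
        using that s by (auto simp: P_def intro!: add_right_mono mult_left_mono)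
      also have "\<dots> = exp (- ((u - t) / 2)) * exp (- ((t - s) / 2)) * excess r (v s)
          + exp (- ((u - t) / 2)) * (e * (t - s)) + e * (u - t)"
        by (simp add: algebra_simps)
      also have "exp (- ((u - t) / 2)) * exp (- ((t - s) / 2)) = exp (- ((u - s) / 2))"
        by (simp add: exp_add[symmetric] field_simps)
      \<comment> \<open>The earlier error does not grow under later contraction, so errors add up to
        \<open>e * (u - s)\<close>.\<close>
      also have "exp (- ((u - t) / 2)) * (e * (t - s)) \<le> 1 * (e * (t - s))"
        using that e by (intro mult_right_mono) auto
      finally show "excess r (v u) \<le> exp (- ((u - s) / 2)) * excess r (v s) + e * (u - s)"
        by (simp add: algebra_simps)
    qed
    have "P 0 T"
    proof (induct rule: Bolzano[OF T])
      case (1 s t u)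
      then show ?case
        using P_trans by blast
    next
      case (2 t)
      obtain d where d: "0 < d"
        and small: "\<And>s. 0 \<le> s \<Longrightarrow> s \<noteq> t \<Longrightarrow> \<bar>s - t\<bar> < d \<Longrightarrow> Lp_norm p \<rho> (q s t) < e"
        using tendstoD[OF deriv[OF 2(1)] e] unfolding eventually_at
        by (auto simp: q_def[abs_def] dist_real_def)
      \<comment> \<open>To the right of \<open>t\<close> the slope is taken at the earlier endpoint.
        The cap 1 in \<open>min d 1\<close> supplies the bound on the step length.\<close>
      have fwd: "P t u" if "t \<le> u" "u - t < min d 1" for u
      proof (cases "u = t")
        case False
        have "excess r (v u) \<le> exp (- ((u - t) / 2)) * excess r (v t) + (u - t) * Lp_norm p \<rho> (q u t)"
          by (rule excess_forward_step[where g = "g t"])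
            (use that False 2 in \<open>auto intro: v q g simp: q_def\<close>)
        also have "(u - t) * Lp_norm p \<rho> (q u t) \<le> e * (u - t)"
          using small[of u] that False 2 by (simp add: mult.commute mult_left_mono)
        finally show ?thesis
          by (simp add: P_def)
      qed (simp add: P_def)
      \<comment> \<open>To the left of \<open>t\<close> the limit still controls the slope at
        \<open>t\<close>, which is now the later endpoint; hence the implicit step.\<close>
      have bwd: "P s t" if "s \<le> t" "t - s < min d 1" for s
      proof (cases "s = t")
        case False
        have "excess r (v t) \<le> exp (- ((t - s) / 2)) * excess r (v s) + (t - s) * Lp_norm p \<rho> (q s t)"
          if s: "0 \<le> s"
        proof (rule excess_backward_step[where g = "g t"])
          show "v s x = v t x - (t - s) * (- v t x + g t x + q s t x)" for x
            using False by (simp add: q_def field_simps)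
        qed (use \<open>s \<le> t\<close> \<open>t - s < min d 1\<close> s 2 in \<open>auto intro: v q g\<close>)
        moreover have "(t - s) * Lp_norm p \<rho> (q s t) \<le> e * (t - s)" if "0 \<le> s"
          using small[of s] \<open>s \<le> t\<close> \<open>t - s < min d 1\<close> False that
          by (simp add: mult.commute mult_left_mono)
        ultimately show ?thesis
          unfolding P_def by fastforce
      qed (simp add: P_def)
      have "P s u" if "s \<le> t" "t \<le> u" "u - s < min d 1" for s u
        using P_trans[OF bwd fwd] that by auto
      then show ?case
        using d by (intro exI[of _ "min d 1"]) auto
    qed
    then show ?thesis
      by (simp add: P_def)
  qed
  show ?thesis
  proof (rule field_le_epsilon)
    fix e :: real assume e: "0 < e"
    \<comment> \<open>Dividing by \<open>T + 1\<close> rather than \<open>T\<close> covers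
      \<open>T = 0\<close>.\<close>
    have "excess r (v T) \<le> exp (- (T / 2)) * excess r (v 0) + e / (T + 1) * T"
      using approx[of "e / (T + 1)"] e T by simp
    also have "e / (T + 1) * T \<le> e"
      using e T by (simp add: field_simps)
    finally show "excess r (v T) \<le> exp (- (T / 2)) * excess r (v 0) + e"
      by simp
  qed
qed

end

section \<open>The bound on the attractor\<close>

theorem theorem4p1:
  fixes J \<rho> :: "real^'n \<Rightarrow> real" and f :: "real \<Rightarrow> real"
    and p h S0 k1 a K :: real
    and S :: "real \<Rightarrow> (real^'n \<Rightarrow> real) set \<Rightarrow> (real^'n \<Rightarrow> real) set"
    and A :: "(real^'n \<Rightarrow> real) set set"
  assumes "1 < p" and "0 < h"
    and "C1_fun J" and "\<And>x. 0 \<le> J x" and "\<And>x. J (- x) = J x"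
    and "closure {x. J x \<noteq> 0} \<subseteq> cball 0 1"
    and "\<And>i. bounded (range (partial_deriv i J))"
    and "0 < S0"
    and "\<And>i. (SUP x. \<integral>\<^sup>+ y. ennreal \<bar>partial_deriv i J (x - y)\<bar> \<partial>lebesgue) \<le> ennreal S0"
    and "\<And>i. (SUP y. \<integral>\<^sup>+ x. ennreal \<bar>partial_deriv i J (x - y)\<bar> \<partial>lebesgue) \<le> ennreal S0"
    and "\<And>x. 0 \<le> f x" and "mono f"
    and "0 < k1" and "\<And>x y. \<bar>f x - f y\<bar> \<le> k1 * \<bar>x - y\<bar>"
    and "0 < a" and "\<And>x. \<bar>f x\<bar> \<le> a"
    and "integrable lebesgue \<rho>" and "\<And>x. 0 < \<rho> x" and "\<And>x. \<rho> (- x) = \<rho> x"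
    and "(LINT x|lebesgue. \<rho> x) = 1"
    and "0 < K" and "\<And>y. (SUP x\<in>{x. norm (x - y) \<le> 1}. ereal (\<rho> x)) \<le> ereal (K * \<rho> y)"
    and "generated_flow p \<rho> J f h S"
    and "global_attractor (Lp p \<rho>) (Lp_dist p \<rho>) S A"
  shows "\<forall>X\<in>A. \<forall>u\<in>X. Linf_norm u \<le> ereal (a * (LINT x|lebesgue. \<bar>J x\<bar>) + h)"
proof (intro ballI)
  fix X u assume XA: "X \<in> A" and uX: "u \<in> X"
  interpret weighted_Lp p \<rho>
    using assms by unfold_locales auto
  interpret M: Metric_space "Lp p \<rho>" "Lp_dist p \<rho>"
    by (rule Metric_space_Lp)
  define r where "r = a * (LINT x|lebesgue. \<bar>J x\<bar>) + h"
  have r: "0 \<le> r"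
    using assms by (simp add: r_def)
  have A: "compactin M.mtopology A" "\<And>t. 0 \<le> t \<Longrightarrow> S t ` A = A"
    using assms(24) by (auto simp: global_attractor_def)
  have A_sub: "A \<subseteq> Lp p \<rho>"
    using compactin_subset_topspace[OF A(1)] by simp
  obtain C where C: "\<And>Y. Y \<in> A \<Longrightarrow> Lp_dist p \<rho> X Y \<le> C"
    using M.compactin_imp_mbounded[OF A(1)] XA unfolding M.mbounded_alt by blast
  \<comment> \<open>Boundedness of \<open>A\<close>, measured from \<open>X\<close>, yields one
    bound on the excess of all its points.\<close>
  define D where "D = Lp_norm p \<rho> (Lp_rep X) + C"
  have excess_A: "excess r (Lp_rep Y) \<le> D" if "Y \<in> A" for Y
  proof -
    have fin: "Lp_rep X \<in> Lp_finite" "Lp_rep Y \<in> Lp_finite"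
      using XA that A_sub by (auto intro: Lp_rep_finite)
    have "Lp_norm p \<rho> (Lp_rep Y) \<le> Lp_norm p \<rho> (Lp_rep X) + Lp_dist p \<rho> Y X"
      using Lp_finite_add(2)[OF fin(1) Lp_finite_diff[OF fin(2,1)]] by (simp add: Lp_dist_def)
    then show ?thesis
      using excess_finite(2)[OF fin(2) r] C[OF that] by (simp add: D_def M.commute)
  qed
  have "continuous_on UNIV f"
  proof (rule lipschitz_on_continuous_on)
    show "k1-lipschitz_on UNIV f"
      using assms by (intro lipschitz_onI) (auto simp: dist_real_def)
  qed
  then have f_meas: "f \<in> borel_measurable borel"
    by (rule borel_measurable_continuous_onI)
  have J_cont: "continuous_on UNIV J"
    using assms by (auto simp: C1_fun_def differentiable_imp_continuous_on)
  have J_supp: "norm x \<le> 1" if "J x \<noteq> 0" for x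
    using assms(6) that closure_subset[of "{x. J x \<noteq> 0}"] by auto
  have kernel: "bounded_kernel J (f \<circ> w) a" if "w \<in> Lp_finite" for w
    using that assms J_cont J_supp f_meas
    by unfold_locales (auto intro: measurable_comp Lp_finite_measurable)
  have decay: "excess r (Lp_rep (S T Y)) \<le> exp (- (T / 2)) * excess r (Lp_rep Y)"
    if "0 \<le> T" "Y \<in> A" for T Y
  proof -
    have Y: "S 0 Y = Y" "global_solution p \<rho> J f h (\<lambda>t. S t Y)"
      using assms(23) A_sub that by (auto simp: generated_flow_def)
    have fin: "Lp_rep (S t Y) \<in> Lp_finite" if "0 \<le> t" for t
      using Y(2) that by (auto simp: global_solution_def intro: Lp_rep_finite)
    \<comment> \<open>The convolution and \<open>h\<close> together form \<open>g\<close>, so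
      \<open>\<bar>g\<bar> \<le> r\<close> and the remaining linear term \<open>- u\<close> drives
      the contraction.\<close>
    have "excess r (Lp_rep (S T Y)) \<le> exp (- (T / 2)) * excess r (Lp_rep (S 0 Y))"
    proof (rule excess_decay[where v = "\<lambda>t. Lp_rep (S t Y)"
          and g = "\<lambda>t x. convol J (f \<circ> Lp_rep (S t Y)) x + h"])
      fix t :: real assume t: "0 \<le> t"
      interpret bounded_kernel J "f \<circ> Lp_rep (S t Y)" a
        by (rule kernel[OF fin[OF t]])
      show "(\<lambda>x. convol J (f \<circ> Lp_rep (S t Y)) x + h) \<in> borel_measurable lebesgue"
        using convol_measurable by simp
      show "\<bar>convol J (f \<circ> Lp_rep (S t Y)) x + h\<bar> \<le> r" for x
        using convol_bound[of x] \<open>0 < h\<close> by (simp add: r_def)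
      show "((\<lambda>s. Lp_norm p \<rho> (\<lambda>x. (Lp_rep (S s Y) x - Lp_rep (S t Y) x) / (s - t)
          - (- Lp_rep (S t Y) x + (convol J (f \<circ> Lp_rep (S t Y)) x + h)))) \<longlongrightarrow> 0) (at t within {0..})"
        using Y(2) t unfolding global_solution_def vfield_def add.assoc by blast
    qed (use that fin in auto)
    then show ?thesis
      by (simp add: Y(1))
  qed
  have "excess r (Lp_rep X) \<le> exp (- (T / 2)) * D" if T: "0 \<le> T" for T
  proof -
    \<comment> \<open>Invariance lets \<open>X\<close> be traced back by any time \<open>T\<close>.
      The preimage \<open>Y\<close> varies with \<open>T\<close>, which is why the uniform bound
      \<open>D\<close> is needed.\<close>
    obtain Y where "Y \<in> A" "S T Y = X"
      using A(2)[OF T] XA by (metis imageE)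
    then have "excess r (Lp_rep X) \<le> exp (- (T / 2)) * excess r (Lp_rep Y)"
      using decay[OF T] by auto
    also have "\<dots> \<le> exp (- (T / 2)) * D"
      using excess_A[OF \<open>Y \<in> A\<close>] by simp
    finally show ?thesis .
  qed
  then have "\<forall>\<^sub>F T in at_top. excess r (Lp_rep X) \<le> exp (- (T / 2)) * D"
    by (auto simp: eventually_at_top_linorder)
  moreover have "((\<lambda>T::real. exp (- (T / 2)) * D) \<longlongrightarrow> 0) at_top"
    by real_asymp
  ultimately have "excess r (Lp_rep X) \<le> 0"
    by (intro tendsto_lowerbound) auto
  then have "excess r (Lp_rep X) = 0"
    by (simp add: excess_def antisym)
  moreover have X: "X \<in> Lp p \<rho>"
    using XA A_sub by auto
  ultimately have "AE x in lebesgue. \<bar>Lp_rep X x\<bar> \<le> r"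
    using excess_eq_0_AE[OF Lp_rep_finite r] by simp
  \<comment> \<open>The estimate concerns the chosen representative; it passes to every member of
    the class almost everywhere.\<close>
  moreover have "AE x in lebesgue. u x = Lp_rep X x"
    using Lp_eq_iff_AE[OF X X uX Lp_rep_in[OF X]] by simp
  ultimately have "AE x in lebesgue. ereal \<bar>u x\<bar> \<le> ereal r"
    by eventually_elim simp
  \<comment> \<open>Measurability is what lets \<open>esssup_I\<close> turn the almost-everywhere
    bound into one on the essential supremum.\<close>
  moreover have "u \<in> borel_measurable lebesgue"
    using uX X in_quotient_imp_subset[OF equiv_AE_eq X[unfolded Lp_def]] Lp_fun_subset
    by (auto dest: Lp_finite_measurable)
  ultimately show "Linf_norm u \<le> ereal (a * (LINT x|lebesgue. \<bar>J x\<bar>) + h)"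
    unfolding Linf_norm_def r_def[symmetric] by (intro esssup_I) auto
qed

end
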